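(* Let $X$ be a non-separable weakly Lindelöf determined (WLD) Banach space. Then there exist two dense linear subspaces $Y$ and $Z$ of $X$ that are not densely isomorphic.
   Context: "Subspace" means linear subspace, not necessarily closed. Two normed spaces $Y$ and $Z$ are densely isomorphic if there exist dense linear subspaces $Y_0$ of $Y$ and $Z_0$ of $Z$ such that $Y_0$ and $Z_0$ are linearly isomorphic (i.e. there is a linear bijection $Y_0\to Z_0$ that is bounded with bounded inverse). A biorthogonal system for a normed space $X$ is a family $\{x_\gamma;x_\gamma^*\}_{\gamma\in\Gamma}\subseteq X\times X^*$ with $\langle x_\alpha^*,x_\beta\rangle=\delta_{\alpha,\beta}$ for all $\alpha,\beta\in\Gamma$. It is an M-basis (Markushevich basis) for $X$ if moreover $\overline{\mathrm{span}}\{x_\gamma\}_{\gamma\in\Gamma}=X$ and $\overline{\mathrm{span}}^{w^*}\{x_\gamma^*\}_{\gamma\in\Gamma}=X^*$. A Banach space $X$ is weakly Lindelöf determined (WLD) if it admits an M-basis $\{x_\gamma;x_\gamma^*\}_{\gamma\in\Gamma}$ such that for every $x^*\in X^*$ the set $\{\gamma\in\Gamma:\langle x^*,x_\gamma\rangle\neq0\}$ is countable. *)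

theory Defs
  imports "HOL-Analysis.Analysis"
begin

text \<open>Normed spaces are over the reals. The dual of \<open>'a\<close> is \<open>'a \<Rightarrow>\<^sub>L real\<close>; for real-valued
  operators the strong operator topology (pointwise convergence) is the weak* topology.\<close>

abbreviation weak_star_topology :: "('a::real_normed_vector \<Rightarrow>\<^sub>L real) topology"
  where "weak_star_topology \<equiv> strong_operator_topology"

definition biorthogonal_system ::
  "'i set \<Rightarrow> ('i \<Rightarrow> 'a::real_normed_vector) \<Rightarrow> ('i \<Rightarrow> 'a \<Rightarrow>\<^sub>L real) \<Rightarrow> bool"
  where "biorthogonal_system \<Gamma> x f \<longleftrightarrow>
    (\<forall>\<alpha>\<in>\<Gamma>. \<forall>\<beta>\<in>\<Gamma>. blinfun_apply (f \<alpha>) (x \<beta>) = (if \<alpha> = \<beta> then 1 else 0))"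

definition M_basis ::
  "'i set \<Rightarrow> ('i \<Rightarrow> 'a::real_normed_vector) \<Rightarrow> ('i \<Rightarrow> 'a \<Rightarrow>\<^sub>L real) \<Rightarrow> bool"
  where "M_basis \<Gamma> x f \<longleftrightarrow>
    biorthogonal_system \<Gamma> x f \<and>
    closure (span (x ` \<Gamma>)) = UNIV \<and>
    weak_star_topology closure_of (span (f ` \<Gamma>)) = UNIV"

definition countably_supports_dual :: "'i set \<Rightarrow> ('i \<Rightarrow> 'a::real_normed_vector) \<Rightarrow> bool"
  where "countably_supports_dual \<Gamma> x \<longleftrightarrow>
    (\<forall>g :: 'a \<Rightarrow>\<^sub>L real. countable {\<gamma>\<in>\<Gamma>. blinfun_apply g (x \<gamma>) \<noteq> 0})"

text \<open>A definition cannot quantify over the index type, so the index set is taken inside \<open>'a\<close>.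
  This loses nothing, since \<open>\<gamma> \<mapsto> x\<^sub>\<gamma>\<close> is injective on a biorthogonal system:
  see \<open>weakly_lindelof_determinedI\<close> below.\<close>

definition weakly_lindelof_determined :: "'a::banach itself \<Rightarrow> bool"
  where "weakly_lindelof_determined _ \<longleftrightarrow>
    (\<exists>(\<Gamma> :: 'a set) (x :: 'a \<Rightarrow> 'a) f. M_basis \<Gamma> x f \<and> countably_supports_dual \<Gamma> x)"

lemma biorthogonal_system_inj_on:
  assumes "biorthogonal_system \<Gamma> x f"
  shows "inj_on x \<Gamma>"
proof (rule inj_onI)
  fix a b assume "a \<in> \<Gamma>" "b \<in> \<Gamma>" "x a = x b"
  then have "blinfun_apply (f a) (x b) = 1"
    using assms unfolding biorthogonal_system_def by metis
  then show "a = b"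
    using assms \<open>a \<in> \<Gamma>\<close> \<open>b \<in> \<Gamma>\<close> unfolding biorthogonal_system_def by (metis zero_neq_one)
qed

lemma weakly_lindelof_determinedI:
  fixes \<Gamma> :: "'i set" and x :: "'i \<Rightarrow> 'a::banach"
  assumes M: "M_basis \<Gamma> x f" and C: "countably_supports_dual \<Gamma> x"
  shows "weakly_lindelof_determined TYPE('a)"
proof -
  have inj: "inj_on x \<Gamma>"
    using M biorthogonal_system_inj_on unfolding M_basis_def by blast
  define h where "h = f \<circ> inv_into \<Gamma> x"
  have hx: "h (x \<gamma>) = f \<gamma>" if "\<gamma> \<in> \<Gamma>" for \<gamma>
    using inj that by (simp add: h_def)
  then have "h ` x ` \<Gamma> = f ` \<Gamma>"
    by (force simp: image_image)
  moreover have "biorthogonal_system (x ` \<Gamma>) id h"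
    using M inj hx unfolding M_basis_def biorthogonal_system_def
    by (auto simp: inj_on_eq_iff)
  ultimately have "M_basis (x ` \<Gamma>) id h"
    using M unfolding M_basis_def by simp
  moreover have "countably_supports_dual (x ` \<Gamma>) id"
    unfolding countably_supports_dual_def
  proof
    fix g :: "'a \<Rightarrow>\<^sub>L real"
    have "{y \<in> x ` \<Gamma>. blinfun_apply g (id y) \<noteq> 0} = x ` {\<gamma>\<in>\<Gamma>. blinfun_apply g (x \<gamma>) \<noteq> 0}"
      by auto
    then show "countable {y \<in> x ` \<Gamma>. blinfun_apply g (id y) \<noteq> 0}"
      using C unfolding countably_supports_dual_def by simp
  qed
  ultimately show ?thesis
    unfolding weakly_lindelof_determined_def by blast
qed

definition linearly_isomorphic ::
  "'a::real_normed_vector set \<Rightarrow> 'b::real_normed_vector set \<Rightarrow> bool"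
  where "linearly_isomorphic Y Z \<longleftrightarrow>
    (\<exists>T. bij_betw T Y Z \<and>
      (\<forall>u\<in>Y. \<forall>v\<in>Y. T (u + v) = T u + T v) \<and>
      (\<forall>c. \<forall>u\<in>Y. T (c *\<^sub>R u) = c *\<^sub>R T u) \<and>
      (\<exists>K. \<forall>u\<in>Y. norm (T u) \<le> K * norm u) \<and>
      (\<exists>K. \<forall>v\<in>Z. norm (inv_into Y T v) \<le> K * norm v))"

text \<open>For \<open>W \<subseteq> Y\<close>, density of \<open>W\<close> in \<open>Y\<close> (as a space in its own right) is \<open>Y \<subseteq> closure W\<close>.\<close>

definition dense_subspace_of :: "'a::real_normed_vector set \<Rightarrow> 'a set \<Rightarrow> bool"
  where "dense_subspace_of W Y \<longleftrightarrow> subspace W \<and> W \<subseteq> Y \<and> Y \<subseteq> closure W"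

definition densely_isomorphic ::
  "'a::real_normed_vector set \<Rightarrow> 'b::real_normed_vector set \<Rightarrow> bool"
  where "densely_isomorphic Y Z \<longleftrightarrow>
    (\<exists>Y\<^sub>0 Z\<^sub>0. dense_subspace_of Y\<^sub>0 Y \<and> dense_subspace_of Z\<^sub>0 Z \<and> linearly_isomorphic Y\<^sub>0 Z\<^sub>0)"

end

theory Submission
  imports Defs
begin

text \<open>Let \<open>Y\<close> be the span of the M-basis. In \<open>X\<close> there is a dense subspace \<open>Z\<close> and an uncountable set
  \<open>A\<close> of indices such that countably many functionals \<open>f (s n)\<close> detect the \<open>A\<close>-coordinates of the vectors of \<open>Z\<close>:
  if all of them vanish at \<open>z \<in> Z\<close>, so do all \<open>f a\<close>, \<open>a \<in> A\<close>. Let \<open>T\<close> be an isomorphism from a dense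
  subspace \<open>Y0\<close> of \<open>Y\<close> onto one of \<open>Z\<close>. As the functionals \<open>f (s n) \<circ> T\<close> extend to \<open>X\<close>, the set \<open>D\<close>
  of indices \<open>\<gamma>\<close> at which one of them does not vanish on \<open>x \<gamma>\<close> is countable. Hence the \<open>A\<close>-coordinates
  of \<open>T y\<close> depend only on the \<open>D\<close>-coordinates of \<open>y\<close>, which form a finitely supported family. So they
  range over a space of countable dimension, and since each vector of \<open>Z\<close> has only finitely many
  nonzero \<open>A\<close>-coordinates, all but countably many \<open>f a\<close> vanish on \<open>T Y0\<close>, which is dense.\<close>

section \<open>Closures of subspaces, separability, and extension of operators by density\<close>

lemma subspace_closure:
  fixes S :: "'a::real_normed_vector set"
  assumes "subspace S"
  shows "subspace (closure S)"
proof (rule subspaceI)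
  show "0 \<in> closure S"
    using subspace_0[OF assms] closure_subset by blast
  show "u + v \<in> closure S" if "u \<in> closure S" "v \<in> closure S" for u v
  proof -
    have "(\<lambda>(u, v). u + v) ` closure (S \<times> S) \<subseteq> closure S"
    proof (rule image_closure_subset)
      show "continuous_on (closure (S \<times> S)) (\<lambda>(u, v). u + v)"
        unfolding case_prod_unfold by (intro continuous_intros)
      show "(\<lambda>(u, v). u + v) ` (S \<times> S) \<subseteq> closure S"
        using subspace_add[OF assms] closure_subset[of S] by auto
    qed simp
    then show ?thesis
      using that by (auto simp: closure_Times)
  qed
  show "c *\<^sub>R u \<in> closure S" if "u \<in> closure S" for c u
  proof -
    have "(*\<^sub>R) c ` closure S \<subseteq> closure S"
      using subspace_scale[OF assms] closure_subset[of S]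
      by (intro image_closure_subset continuous_intros) auto
    then show ?thesis
      using that by blast
  qed
qed

text \<open>Finite combinations with rational coefficients form a countable dense set. They are
  coded by lists of pairs (coefficient, vector), so that countability is that of lists and adding a
  term is prepending a pair.\<close>

lemma separable_space_closure_span:
  fixes S :: "'a::real_normed_vector set"
  assumes "countable S" "closure (span S) = UNIV"
  shows "separable_space (euclidean :: 'a topology)"
proof -
  define C where
    "C = (\<lambda>l. \<Sum>(q, s)\<leftarrow>l. q *\<^sub>R s) ` lists ((\<rat> :: real set) \<times> S)"
  have "countable C"
    unfolding C_def using assms(1) countable_rat by (intro countable_image countable_lists) auto
  have C_step: "q *\<^sub>R s + c \<in> C" if q: "q \<in> \<rat>" "s \<in> S" and c: "c \<in> C" for q s c
  proof -
    obtain l where l: "l \<in> lists (\<rat> \<times> S)" "c = (\<Sum>(q, s)\<leftarrow>l. q *\<^sub>R s)"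
      using c unfolding C_def by blast
    have "(q, s) # l \<in> lists (\<rat> \<times> S)"
      using q l by simp
    moreover have "q *\<^sub>R s + c = (\<Sum>(q, s)\<leftarrow>(q, s) # l. q *\<^sub>R s)"
      using l by simp
    ultimately show ?thesis
      unfolding C_def by (rule rev_image_eqI)
  qed
  have "span S \<subseteq> closure C"
  proof
    fix v assume "v \<in> span S"
    then show "v \<in> closure C"
    proof (induction rule: span_induct_alt)
      case base
      have "0 \<in> C"
        unfolding C_def by (rule image_eqI[of _ _ "[]"]) auto
      then show ?case
        using closure_subset by blast
    next
      case (step r s y)
      \<comment> \<open>Joint continuity allows the real coefficient \<open>r\<close> and the limit
        point \<open>y\<close> to be approximated simultaneously.\<close>
      have "(\<lambda>(q, c). q *\<^sub>R s + c) ` closure (\<rat> \<times> C) \<subseteq> closure C"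
      proof (rule image_closure_subset)
        show "continuous_on (closure (\<rat> \<times> C)) (\<lambda>(q, c). q *\<^sub>R s + c)"
          unfolding case_prod_unfold by (intro continuous_intros)
        show "(\<lambda>(q, c). q *\<^sub>R s + c) ` (\<rat> \<times> C) \<subseteq> closure C"
          using C_step step.hyps closure_subset[of C]
          by auto
      qed simp
      moreover have "(r, y) \<in> closure (\<rat> \<times> C)"
        using step by (simp add: closure_Times Rats_closure_real)
      ultimately show ?case
        by fastforce
    qed
  qed
  then have "closure (span S) \<subseteq> closure C"
    by (simp add: closure_minimal)
  then have "closure C = UNIV"
    using assms(2) by auto
  then show ?thesis
    unfolding separable_space_def using \<open>countable C\<close> by (auto simp: euclidean_closure_of)
qed

text \<open>A bounded linear map is uniformly continuous, so completeness of the target extends it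
  to the closure. Additivity, homogeneity and the norm bound are closed conditions and pass from
  \<open>Y\<close> to the whole space.\<close>

lemma bounded_linear_extension_dense:
  fixes T :: "'a::real_normed_vector \<Rightarrow> 'b::banach"
  assumes Y: "subspace Y" "closure Y = UNIV"
    and add: "\<And>u v. u \<in> Y \<Longrightarrow> v \<in> Y \<Longrightarrow> T (u + v) = T u + T v"
    and scale: "\<And>c u. u \<in> Y \<Longrightarrow> T (c *\<^sub>R u) = c *\<^sub>R T u"
    and bound: "\<And>u. u \<in> Y \<Longrightarrow> norm (T u) \<le> K * norm u"
  obtains T' :: "'a \<Rightarrow>\<^sub>L 'b" where "\<And>u. u \<in> Y \<Longrightarrow> blinfun_apply T' u = T u"
proof -
  have diff: "T (u - v) = T u - T v" if "u \<in> Y" "v \<in> Y" for u v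
    using add[OF that(1) subspace_scale[OF Y(1) that(2), of "-1"]] scale[OF that(2), of "-1"] by simp
  have "uniformly_continuous_on Y T"
    unfolding uniformly_continuous_on_def
  proof (intro allI impI)
    fix e :: real assume "e > 0"
    \<comment> \<open>\<open>K\<close> may be zero or negative, whereas the modulus
      \<open>e / L\<close> needs a positive constant.\<close>
    define L where "L = \<bar>K\<bar> + 1"
    have "L > 0"
      unfolding L_def by linarith
    have "dist (T v) (T u) < e" if uv: "u \<in> Y" "v \<in> Y" "dist v u < e / L" for u v
    proof -
      have "dist (T v) (T u) = norm (T (v - u))"
        using diff uv by (simp add: dist_norm)
      also have "\<dots> \<le> K * norm (v - u)"
        using bound uv Y(1) by (blast intro: subspace_diff)
      also have "\<dots> \<le> L * norm (v - u)"
        unfolding L_def by (intro mult_right_mono) auto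
      also have "\<dots> < e"
        using uv(3) \<open>L > 0\<close> by (simp add: dist_norm field_simps)
      finally show ?thesis .
    qed
    then show "\<exists>d>0. \<forall>x\<in>Y. \<forall>x'\<in>Y. dist x' x < d \<longrightarrow> dist (T x') (T x) < e"
      using \<open>e > 0\<close> \<open>L > 0\<close> by (intro exI[of _ "e / L"]) auto
  qed
  then obtain g where "uniformly_continuous_on (closure Y) g" and gT: "\<And>u. u \<in> Y \<Longrightarrow> T u = g u"
    using uniformly_continuous_on_extension_on_closure by metis
  then have cont: "continuous_on UNIV g"
    using Y(2) uniformly_continuous_imp_continuous by metis
  have cont': "continuous_on UNIV (\<lambda>x. g (h x))" if "continuous_on UNIV h" for h :: "'c::topological_space \<Rightarrow> 'a"
    using continuous_on_compose2[OF cont that] by simp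
  have "g (u + v) = g u + g v" for u v
  proof -
    have "closed {p. g (fst p + snd p) = g (fst p) + g (snd p)}"
      by (intro closed_Collect_eq continuous_intros cont')
    moreover have "Y \<times> Y \<subseteq> {p. g (fst p + snd p) = g (fst p) + g (snd p)}"
      by (auto simp: add Y(1) subspace_add simp flip: gT)
    ultimately have "closure (Y \<times> Y) \<subseteq> {p. g (fst p + snd p) = g (fst p) + g (snd p)}"
      by (rule closure_minimal[rotated])
    then show ?thesis
      using Y(2) by (simp add: closure_Times subset_iff)
  qed
  moreover have "g (c *\<^sub>R u) = c *\<^sub>R g u" for c u
  proof -
    have "closed {u. g (c *\<^sub>R u) = c *\<^sub>R g u}"
      by (intro closed_Collect_eq continuous_intros cont')
    moreover have "Y \<subseteq> {u. g (c *\<^sub>R u) = c *\<^sub>R g u}"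
      by (auto simp: scale Y(1) subspace_scale simp flip: gT)
    ultimately show ?thesis
      using Y(2) closure_minimal by blast
  qed
  moreover have "norm (g u) \<le> norm u * K" for u
  proof -
    have "closed {u. norm (g u) \<le> norm u * K}"
      by (intro closed_Collect_le continuous_intros cont')
    moreover have "Y \<subseteq> {u. norm (g u) \<le> norm u * K}"
      by (auto simp: bound mult.commute[of _ K] simp flip: gT)
    ultimately show ?thesis
      using Y(2) closure_minimal by blast
  qed
  ultimately have "bounded_linear g"
    by (rule bounded_linear_intro)
  then show thesis
    using that[of "Blinfun g"] gT by (simp add: bounded_linear_Blinfun_apply)
qed

section \<open>Linear algebra of geometric progressions and of families of functionals\<close>

text \<open>A Vandermonde-type independence of geometric progressions with distinct ratios. It is
  stated for tails, where a ratio 0 would leave no trace; hence the ratios are nonzero.\<close>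

lemma power_sums_eventually_zero:
  fixes t \<phi> :: "'i \<Rightarrow> real"
  assumes "finite F" "inj_on \<phi> F" "\<And>a. a \<in> F \<Longrightarrow> \<phi> a \<noteq> 0"
    and "\<And>n. n \<ge> N \<Longrightarrow> (\<Sum>a\<in>F. t a * \<phi> a ^ n) = 0"
  shows "\<forall>a\<in>F. t a = 0"
  using assms
proof (induction F arbitrary: t rule: finite_induct)
  case empty
  then show ?case by simp
next
  case (insert b F)
  have sum_F: "(\<Sum>a\<in>F. t a * \<phi> a ^ n) = - (t b * \<phi> b ^ n)" if "n \<ge> N" for n
    using insert.prems(3)[OF that] insert.hyps by simp
  \<comment> \<open>Subtracting \<open>\<phi> b\<close> times the relation at \<open>n\<close> from
    the relation at \<open>Suc n\<close> cancels the \<open>b\<close>-term and multiplies each other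
    coefficient by the nonzero factor \<open>\<phi> a - \<phi> b\<close>.\<close>
  have "(\<Sum>a\<in>F. t a * (\<phi> a - \<phi> b) * \<phi> a ^ n) = 0" if "n \<ge> N" for n
  proof -
    have "(\<Sum>a\<in>F. t a * (\<phi> a - \<phi> b) * \<phi> a ^ n)
        = (\<Sum>a\<in>F. t a * \<phi> a ^ Suc n) - \<phi> b * (\<Sum>a\<in>F. t a * \<phi> a ^ n)"
      by (simp add: sum_distrib_left sum_subtractf algebra_simps)
    also have "\<dots> = 0"
      using that by (simp only: sum_F le_SucI) simp
    finally show ?thesis .
  qed
  then have "\<forall>a\<in>F. t a * (\<phi> a - \<phi> b) = 0"
    using insert.prems by (intro insert.IH) auto
  then have F: "\<forall>a\<in>F. t a = 0"
    using insert.prems(1) insert.hyps by (simp add: image_iff) metis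
  then have "t b * \<phi> b ^ N = 0"
    using insert.prems(3)[of N] insert.hyps by simp
  then show ?case
    using F insert.prems(2) by simp
qed

text \<open>Passing to the kernel of one functional costs only the support of one vector.\<close>

lemma countable_total_support:
  fixes \<phi> :: "'i \<Rightarrow> 'a::real_vector \<Rightarrow> real" and \<psi> :: "'j \<Rightarrow> 'a \<Rightarrow> real"
  assumes "finite F" "subspace V" "\<And>i. linear (\<phi> i)" "\<And>a. linear (\<psi> a)"
    and "\<And>y. y \<in> V \<Longrightarrow> countable {a\<in>A. \<psi> a y \<noteq> 0}"
    and "countable {a\<in>A. \<exists>y\<in>V. (\<forall>i\<in>F. \<phi> i y = 0) \<and> \<psi> a y \<noteq> 0}"
  shows "countable {a\<in>A. \<exists>y\<in>V. \<psi> a y \<noteq> 0}"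
  using assms
proof (induction F arbitrary: V rule: finite_induct)
  case empty
  then show ?case by simp
next
  case (insert i F)
  let ?V = "{y \<in> V. \<phi> i y = 0}"
  have sub: "subspace ?V"
    using insert.prems(1,2) by (auto simp: subspace_def linear_add linear_scale linear_0)
  have "{a\<in>A. \<exists>y\<in>?V. (\<forall>j\<in>F. \<phi> j y = 0) \<and> \<psi> a y \<noteq> 0}
      = {a\<in>A. \<exists>y\<in>V. (\<forall>j\<in>insert i F. \<phi> j y = 0) \<and> \<psi> a y \<noteq> 0}"
    by auto
  then have ker: "countable {a\<in>A. \<exists>y\<in>?V. \<psi> a y \<noteq> 0}"
    using insert.prems by (intro insert.IH[OF sub]) auto
  show ?case
  proof (cases "?V = V")
    case True
    then show ?thesis using ker by simp
  next
    case False
    then obtain z where z: "z \<in> V" "\<phi> i z \<noteq> 0" by blast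
    have "\<psi> a z \<noteq> 0 \<or> (\<exists>y\<in>?V. \<psi> a y \<noteq> 0)" if y: "y \<in> V" "\<psi> a y \<noteq> 0" for a y
    proof -
      let ?y = "y - (\<phi> i y / \<phi> i z) *\<^sub>R z"
      have "?y \<in> ?V"
        using y z insert.prems(1,2)
        by (auto simp: linear_diff linear_scale intro!: subspace_diff subspace_scale)
      moreover have "\<psi> a ?y = \<psi> a y - (\<phi> i y / \<phi> i z) * \<psi> a z"
        using insert.prems(3) by (simp add: linear_diff linear_scale)
      ultimately show ?thesis
        using y(2) by (metis diff_zero mult_zero_right)
    qed
    then have "{a\<in>A. \<exists>y\<in>V. \<psi> a y \<noteq> 0} \<subseteq> {a\<in>A. \<psi> a z \<noteq> 0} \<union> {a\<in>A. \<exists>y\<in>?V. \<psi> a y \<noteq> 0}"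
      by blast
    moreover have "countable ({a\<in>A. \<psi> a z \<noteq> 0} \<union> {a\<in>A. \<exists>y\<in>?V. \<psi> a y \<noteq> 0})"
      using ker insert.prems(4)[OF z(1)] by simp
    ultimately show ?thesis
      by (rule countable_subset)
  qed
qed

section \<open>Finite expansions with respect to a biorthogonal system\<close>

lemma span_image_sumE:
  assumes "y \<in> span (x ` S)"
  obtains F r where "finite F" "F \<subseteq> S" "y = (\<Sum>i\<in>F. r i *\<^sub>R x i)"
proof -
  obtain G q where G: "finite G" "G \<subseteq> x ` S" "y = (\<Sum>v\<in>G. q v *\<^sub>R v)"
    using assms unfolding span_explicit by blast
  \<comment> \<open>One index is picked for each vector of \<open>G\<close>, so the family may
    repeat vectors.\<close>
  obtain F where F: "F \<subseteq> S" "inj_on x F" "G = x ` F"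
    using G(2) by (auto simp: subset_image_inj)
  have "finite F"
    using G(1) F finite_imageD by blast
  moreover have "y = (\<Sum>i\<in>F. q (x i) *\<^sub>R x i)"
    using G(3) F by (simp add: sum.reindex)
  ultimately show thesis
    using F(1) that[of F "q \<circ> x"] by simp
qed

lemma biorthogonal_system_sum:
  assumes "biorthogonal_system \<Gamma> x f" "finite F" "F \<subseteq> \<Gamma>" "\<gamma> \<in> \<Gamma>"
  shows "blinfun_apply (f \<gamma>) (\<Sum>i\<in>F. r i *\<^sub>R x i) = (if \<gamma> \<in> F then r \<gamma> else 0)"
proof -
  have "blinfun_apply (f \<gamma>) (\<Sum>i\<in>F. r i *\<^sub>R x i) = (\<Sum>i\<in>F. if \<gamma> = i then r i else 0)"
    unfolding blinfun.sum_right blinfun.scaleR_right using assms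
    by (intro sum.cong) (auto simp: biorthogonal_system_def)
  then show ?thesis
    using assms(2) by simp
qed

lemma biorthogonal_system_expansion:
  assumes "biorthogonal_system \<Gamma> x f" "y \<in> span (x ` \<Gamma>)"
  obtains F where "finite F" "F \<subseteq> \<Gamma>" "\<And>\<gamma>. \<gamma> \<in> \<Gamma> - F \<Longrightarrow> blinfun_apply (f \<gamma>) y = 0"
    "y = (\<Sum>\<gamma>\<in>F. blinfun_apply (f \<gamma>) y *\<^sub>R x \<gamma>)"
proof -
  obtain F r where F: "finite F" "F \<subseteq> \<Gamma>" and y: "y = (\<Sum>i\<in>F. r i *\<^sub>R x i)"
    using assms(2) by (rule span_image_sumE)
  note c = biorthogonal_system_sum[OF assms(1) F, of _ r, folded y]
  have "y = (\<Sum>\<gamma>\<in>F. blinfun_apply (f \<gamma>) y *\<^sub>R x \<gamma>)"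
    using c F(2) by (subst y) (intro sum.cong, auto)
  then show thesis
    using that[OF F] c by simp
qed

section \<open>Construction of the perturbed dense subspace\<close>

text \<open>This supplies distinct ratios in (0,1). By comparability of cardinals, either
  \<open>S\<close> embeds into the interval and serves itself, or the interval embeds into
  \<open>S\<close> and its image serves, with the inverse map.\<close>

lemma uncountable_subset_inj_into_unit_interval:
  assumes "uncountable S"
  obtains A and \<phi> :: "'a \<Rightarrow> real" where "A \<subseteq> S" "uncountable A" "inj_on \<phi> A" "\<phi> ` A \<subseteq> {0<..<1}"
proof -
  let ?I = "{0<..<1::real}"
  consider "(card_of S, card_of ?I) \<in> ordLeq" | "(card_of ?I, card_of S) \<in> ordLeq"
    using ordLeq_total[OF card_of_Well_order card_of_Well_order] by blast
  then show thesis
  proof cases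
    case 1
    then obtain \<phi> where "inj_on \<phi> S" "\<phi> ` S \<subseteq> ?I"
      using card_of_ordLeq[of S ?I] by blast
    then show thesis
      using that[OF subset_refl assms] by blast
  next
    case 2
    then obtain h where h: "inj_on h ?I" "h ` ?I \<subseteq> S"
      using card_of_ordLeq[of ?I S] by blast
    have "uncountable (h ` ?I)"
      using countable_image_inj_on[OF _ h(1)] uncountable_open_interval[of 0 "1::real"] by auto
    moreover have "inv_into ?I h ` h ` ?I \<subseteq> ?I"
      using h(1) by auto
    ultimately show thesis
      using that[OF h(2)] inj_on_inv_into[OF subset_refl] by blast
  qed
qed


text \<open>Perturbing \<open>x a\<close> to \<open>x a + v a\<close>, where the vectors \<open>v a\<close> lie in the closed span of a fixed
  sequence of other basis vectors and have the geometric progressions \<open>\<phi> a ^ n\<close> as coordinates,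
  keeps the span dense but lets countably many functionals detect the coordinates in \<open>A\<close>.\<close>

lemma dense_subspace_countably_detected:
  fixes x :: "'i \<Rightarrow> 'a::banach"
  assumes B: "biorthogonal_system \<Gamma> x f" and dense: "closure (span (x ` \<Gamma>)) = UNIV"
    and unc: "uncountable \<Gamma>"
  obtains Z A and s :: "nat \<Rightarrow> 'i" where "subspace Z" "closure Z = UNIV" "A \<subseteq> \<Gamma>" "uncountable A"
    "range s \<subseteq> \<Gamma>" "\<And>z. z \<in> Z \<Longrightarrow> finite {a\<in>A. blinfun_apply (f a) z \<noteq> 0}"
    "\<And>z a. z \<in> Z \<Longrightarrow> \<forall>n. blinfun_apply (f (s n)) z = 0 \<Longrightarrow> a \<in> A \<Longrightarrow> blinfun_apply (f a) z = 0"
proof -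
  have "infinite \<Gamma>"
    using unc uncountable_infinite by blast
  then obtain s :: "nat \<Rightarrow> 'i" where s: "inj s" "range s \<subseteq> \<Gamma>"
    using infinite_countable_subset by blast
  \<comment> \<open>\<open>A\<close> is chosen off the sequence \<open>s\<close>, so that the
    perturbations \<open>v a\<close> have no coordinates in \<open>A\<close>.\<close>
  have "uncountable (\<Gamma> - range s)"
    using unc by (simp add: uncountable_minus_countable)
  then obtain A and \<phi> :: "'i \<Rightarrow> real" where A: "A \<subseteq> \<Gamma> - range s" "uncountable A"
    and \<phi>: "inj_on \<phi> A" "\<phi> ` A \<subseteq> {0<..<1}"
    by (rule uncountable_subset_inj_into_unit_interval)
  \<comment> \<open>These weights dominate the series for \<open>v a\<close> by a geometric one,
    since \<open>\<phi> a\<close> lies in (0,1). Being positive, they can later be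
    cancelled.\<close>
  define c where "c n = (1/2) ^ n / (1 + norm (x (s n)))" for n
  have c_pos: "c n > 0" for n
    unfolding c_def by (simp add: add_pos_nonneg)
  have c_norm: "c n * norm (x (s n)) \<le> (1/2) ^ n" for n
    unfolding c_def by (simp add: field_simps add_pos_nonneg)
  define v where "v a = (\<Sum>n. (c n * \<phi> a ^ n) *\<^sub>R x (s n))" for a
  have summ: "summable (\<lambda>n. (c n * \<phi> a ^ n) *\<^sub>R x (s n))" if "a \<in> A" for a
  proof (rule summable_comparison_test[OF _ summable_geometric])
    have "norm ((c n * \<phi> a ^ n) *\<^sub>R x (s n)) \<le> (1/2) ^ n" for n
    proof -
      have "0 < \<phi> a" "\<phi> a < 1"
        using \<phi>(2) that by auto
      then have "\<phi> a ^ n \<le> 1"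
        by (simp add: power_le_one)
      then have "(c n * norm (x (s n))) * \<phi> a ^ n \<le> c n * norm (x (s n))"
        using c_pos[of n] by (intro mult_left_le) auto
      then show ?thesis
        using order.trans[OF _ c_norm[of n]] c_pos[of n] \<open>0 < \<phi> a\<close>
        by (simp add: abs_mult mult_ac del: mult_le_cancel_left_pos mult_le_cancel_left1)
    qed
    then show "\<exists>N. \<forall>n\<ge>N. norm ((c n * \<phi> a ^ n) *\<^sub>R x (s n)) \<le> (1/2) ^ n" by blast
  qed simp
  \<comment> \<open>Continuity lets \<open>f \<gamma>\<close> act termwise, and biorthogonality
    leaves only the terms with \<open>s n = \<gamma>\<close>.\<close>
  have fv: "blinfun_apply (f \<gamma>) (v a) = (\<Sum>n. if \<gamma> = s n then c n * \<phi> a ^ n else 0)"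
    if "a \<in> A" "\<gamma> \<in> \<Gamma>" for a \<gamma>
  proof -
    have "blinfun_apply (f \<gamma>) (v a) = (\<Sum>n. blinfun_apply (f \<gamma>) ((c n * \<phi> a ^ n) *\<^sub>R x (s n)))"
      unfolding v_def
      by (rule bounded_linear.suminf[OF blinfun.bounded_linear_right summ[OF that(1)]])
    also have "\<dots> = (\<Sum>n. if \<gamma> = s n then c n * \<phi> a ^ n else 0)"
      using B that(2) s(2)
      by (intro suminf_cong) (simp add: blinfun.scaleR_right biorthogonal_system_def range_subsetD)
    finally show ?thesis .
  qed
  have fv_s: "blinfun_apply (f (s m)) (v a) = c m * \<phi> a ^ m" if "a \<in> A" for a m
  proof -
    have "(\<lambda>n. if s m = s n then c n * \<phi> a ^ n else 0) = (\<lambda>n. if n = m then c n * \<phi> a ^ n else 0)"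
      using s(1) by (auto simp: inj_eq)
    moreover have "(\<lambda>n. if n = m then c n * \<phi> a ^ n else 0) sums (c m * \<phi> a ^ m)"
      by (rule sums_single)
    ultimately show ?thesis
      using fv[of a "s m"] that s(2) by (auto simp: sums_iff)
  qed
  have fv_A: "blinfun_apply (f b) (v a) = 0" if "a \<in> A" "b \<in> A" for a b
  proof -
    have "(\<lambda>n. if b = s n then c n * \<phi> a ^ n else 0) = (\<lambda>n. 0)"
      using A(1) that(2) by (intro ext if_not_P) blast
    then show ?thesis
      using fv[of a b] that A(1) by (auto simp: subset_iff)
  qed
  \<comment> \<open>Only vectors with index in \<open>A\<close> are perturbed. All
    \<open>x (s n)\<close> stay in \<open>Z\<close>, so \<open>v a\<close> is a limit of partial
    sums in \<open>Z\<close>, and \<open>x a\<close> is recovered in \<open>closure Z\<close> as a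
    difference.\<close>
  define Z where "Z = span (x ` (\<Gamma> - A) \<union> (\<lambda>a. x a + v a) ` A)"
  have Z: "subspace Z"
    unfolding Z_def by simp
  have base: "x \<gamma> \<in> Z" if "\<gamma> \<in> \<Gamma> - A" for \<gamma>
    unfolding Z_def using that by (blast intro: span_base)
  have v_Z: "v a \<in> closure Z" if "a \<in> A" for a
  proof -
    have "(\<Sum>n<k. (c n * \<phi> a ^ n) *\<^sub>R x (s n)) \<in> Z" for k
      using A(1) s(2) by (intro subspace_sum[OF Z] subspace_scale[OF Z] base) blast
    then show ?thesis
      unfolding closure_sequential v_def
      by (intro exI[of _ "\<lambda>k. \<Sum>n<k. (c n * \<phi> a ^ n) *\<^sub>R x (s n)"] conjI allI
          summable_LIMSEQ[OF summ[OF that]])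
  qed
  have "x ` \<Gamma> \<subseteq> closure Z"
  proof
    fix y assume "y \<in> x ` \<Gamma>"
    then obtain \<gamma> where \<gamma>: "\<gamma> \<in> \<Gamma>" "y = x \<gamma>" by blast
    show "y \<in> closure Z"
    proof (cases "\<gamma> \<in> A")
      case False
      then show ?thesis
        using base \<gamma> closure_subset by blast
    next
      case True
      then have "x \<gamma> + v \<gamma> \<in> Z"
        unfolding Z_def by (blast intro: span_base)
      then have "(x \<gamma> + v \<gamma>) - v \<gamma> \<in> closure Z"
        using v_Z[OF True] closure_subset subspace_closure[OF Z] by (blast intro: subspace_diff)
      then show ?thesis
        using \<gamma>(2) by simp
    qed
  qed
  then have "span (x ` \<Gamma>) \<subseteq> closure Z"
    by (rule span_minimal[OF _ subspace_closure[OF Z]])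
  then have Z_dense: "closure Z = UNIV"
    using dense by (metis closure_closure closure_mono top.extremum_unique)
  \<comment> \<open>Write \<open>z = u + w\<close> with \<open>u\<close> unperturbed and
    \<open>w\<close> perturbed. The coefficients \<open>t\<close> of \<open>w\<close> are the
    \<open>A\<close>-coordinates of \<open>z\<close>; at \<open>s n\<close> they reappear as a
    weighted power sum, disturbed by the finitely many coefficients \<open>r\<close> of
    \<open>u\<close>.\<close>
  have coords: "\<exists>F t G r. finite F \<and> F \<subseteq> A \<and> finite G \<and>
      (\<forall>a\<in>A. blinfun_apply (f a) z = (if a \<in> F then t a else 0)) \<and>
      (\<forall>n. blinfun_apply (f (s n)) z = (if s n \<in> G then r (s n) else 0) + c n * (\<Sum>a\<in>F. t a * \<phi> a ^ n))"
    if z_Z: "z \<in> Z" for z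
  proof -
    obtain u w where u: "u \<in> span (x ` (\<Gamma> - A))" and w: "w \<in> span ((\<lambda>a. x a + v a) ` A)"
      and z: "z = u + w"
      using z_Z unfolding Z_def span_Un by blast
    obtain G r where G: "finite G" "G \<subseteq> \<Gamma> - A" "u = (\<Sum>i\<in>G. r i *\<^sub>R x i)"
      using u by (rule span_image_sumE)
    obtain F t where F: "finite F" "F \<subseteq> A" "w = (\<Sum>a\<in>F. t a *\<^sub>R (x a + v a))"
      using w by (rule span_image_sumE)
    have w': "w = (\<Sum>a\<in>F. t a *\<^sub>R x a) + (\<Sum>a\<in>F. t a *\<^sub>R v a)"
      using F(3) by (simp add: scaleR_add_right sum.distrib)
    have G': "G \<subseteq> \<Gamma>" and F': "F \<subseteq> \<Gamma>"
      using G(2) F(2) A(1) by auto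
    have f_z: "blinfun_apply (f \<gamma>) z = (if \<gamma> \<in> G then r \<gamma> else 0) + (if \<gamma> \<in> F then t \<gamma> else 0)
        + (\<Sum>a\<in>F. t a * blinfun_apply (f \<gamma>) (v a))" if "\<gamma> \<in> \<Gamma>" for \<gamma>
      using biorthogonal_system_sum[OF B G(1) G' that, of r]
        biorthogonal_system_sum[OF B F(1) F' that, of t]
      by (simp add: z w' G(3) blinfun.add_right blinfun.sum_right blinfun.scaleR_right)
    have "blinfun_apply (f a) z = (if a \<in> F then t a else 0)" if "a \<in> A" for a
    proof -
      have "(\<Sum>b\<in>F. t b * blinfun_apply (f a) (v b)) = 0"
        using F(2) fv_A that by (intro sum.neutral) auto
      moreover have "a \<in> \<Gamma>" "a \<notin> G"
        using that A(1) G(2) by auto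
      ultimately show ?thesis
        using f_z by simp
    qed
    moreover have "blinfun_apply (f (s n)) z = (if s n \<in> G then r (s n) else 0) + c n * (\<Sum>a\<in>F. t a * \<phi> a ^ n)" for n
    proof -
      have "(\<Sum>a\<in>F. t a * blinfun_apply (f (s n)) (v a)) = c n * (\<Sum>a\<in>F. t a * \<phi> a ^ n)"
        unfolding sum_distrib_left using F(2) fv_s by (intro sum.cong) auto
      moreover have "s n \<in> \<Gamma>" "s n \<notin> F"
        using s(2) A(1) F(2) by auto
      ultimately show ?thesis
        using f_z by simp
    qed
    ultimately show ?thesis
      using F(1,2) G(1) by (intro exI[of _ F] exI[of _ t] exI[of _ G] exI[of _ r]) simp
  qed
  show thesis
  proof (rule that[OF Z Z_dense _ A(2) s(2)])
    show "A \<subseteq> \<Gamma>"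
      using A(1) by blast
    fix z assume "z \<in> Z"
    then obtain F t G r where F: "finite F" "F \<subseteq> A" and G: "finite G"
      and f_A: "\<forall>a\<in>A. blinfun_apply (f a) z = (if a \<in> F then t a else 0)"
      and f_s: "\<forall>n. blinfun_apply (f (s n)) z
        = (if s n \<in> G then r (s n) else 0) + c n * (\<Sum>a\<in>F. t a * \<phi> a ^ n)"
      using coords[OF \<open>z \<in> Z\<close>] by (elim exE conjE) (rule that)
    have "{a\<in>A. blinfun_apply (f a) z \<noteq> 0} \<subseteq> F"
      using f_A by (auto split: if_splits)
    then show "finite {a\<in>A. blinfun_apply (f a) z \<noteq> 0}"
      using F(1) by (rule finite_subset)
    fix a assume zero: "\<forall>n. blinfun_apply (f (s n)) z = 0" and "a \<in> A"
    \<comment> \<open>As \<open>s\<close> is injective, \<open>u\<close> affects only finitely many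
      of the coordinates at \<open>s n\<close>. Past \<open>N\<close> their vanishing says that the
      power sums vanish.\<close>
    have "finite (s -` G)"
      using G s(1) by (rule finite_vimageI)
    then obtain N where N: "\<forall>n\<in>s -` G. n < N"
      using finite_nat_set_iff_bounded by blast
    have "(\<Sum>a\<in>F. t a * \<phi> a ^ n) = 0" if "n \<ge> N" for n
    proof -
      have "s n \<notin> G"
        using N that by (metis leD vimageI)
      then show ?thesis
        using spec[OF f_s, of n] spec[OF zero, of n] c_pos[of n] by simp
    qed
    moreover have "inj_on \<phi> F" "\<And>a. a \<in> F \<Longrightarrow> \<phi> a \<noteq> 0"
      using inj_on_subset[OF \<phi>(1) F(2)] \<phi>(2) F(2) by force+
    ultimately have "\<forall>a\<in>F. t a = 0"
      using power_sums_eventually_zero[OF F(1)] by blast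
    then show "blinfun_apply (f a) z = 0"
      using f_A \<open>a \<in> A\<close> by simp
  qed
qed

section \<open>No dense isomorphism between the span of the basis and its perturbation\<close>

theorem theoremA:
  assumes "\<not> separable_space (euclidean :: 'a::banach topology)"
    and "weakly_lindelof_determined TYPE('a)"
  shows "\<exists>(Y :: 'a set) (Z :: 'a set). dense_subspace_of Y UNIV \<and> dense_subspace_of Z UNIV \<and>
    \<not> densely_isomorphic Y Z"
proof -
  obtain \<Gamma> :: "'a set" and x :: "'a \<Rightarrow> 'a" and f where M: "M_basis \<Gamma> x f"
    and supp: "countably_supports_dual \<Gamma> x"
    using assms(2) unfolding weakly_lindelof_determined_def by blast
  have B: "biorthogonal_system \<Gamma> x f" and dense: "closure (span (x ` \<Gamma>)) = UNIV"
    using M unfolding M_basis_def by auto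
  have "uncountable \<Gamma>"
    using assms(1) separable_space_closure_span[OF countable_image dense] by blast
  then obtain Z A and s :: "nat \<Rightarrow> 'a" where Z: "subspace Z" "closure Z = UNIV"
    and A: "A \<subseteq> \<Gamma>" "uncountable A" and s: "range s \<subseteq> \<Gamma>"
    and fin: "\<And>z. z \<in> Z \<Longrightarrow> finite {a\<in>A. blinfun_apply (f a) z \<noteq> 0}"
    and detect: "\<And>z a. z \<in> Z \<Longrightarrow> \<forall>n. blinfun_apply (f (s n)) z = 0 \<Longrightarrow> a \<in> A \<Longrightarrow> blinfun_apply (f a) z = 0"
    using dense_subspace_countably_detected[OF B dense] by blast
  define Y where "Y = span (x ` \<Gamma>)"
  have "\<not> densely_isomorphic Y Z"
  proof
    assume "densely_isomorphic Y Z"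
    then obtain Y0 Z0 T K where Y0: "subspace Y0" "Y0 \<subseteq> Y" "Y \<subseteq> closure Y0"
      and Z0: "Z0 \<subseteq> Z" "Z \<subseteq> closure Z0"
      and T: "bij_betw T Y0 Z0" "\<And>u v. u \<in> Y0 \<Longrightarrow> v \<in> Y0 \<Longrightarrow> T (u + v) = T u + T v"
        "\<And>c u. u \<in> Y0 \<Longrightarrow> T (c *\<^sub>R u) = c *\<^sub>R T u" "\<And>u. u \<in> Y0 \<Longrightarrow> norm (T u) \<le> K * norm u"
      unfolding densely_isomorphic_def dense_subspace_of_def linearly_isomorphic_def by metis
    have Y0_span: "y \<in> span (x ` \<Gamma>)" if "y \<in> Y0" for y
      using that Y0(2) unfolding Y_def by blast
    have "closure Y0 = UNIV"
      using Y0(3) dense unfolding Y_def by (metis closure_closure closure_mono top.extremum_unique)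
    have "closure Z0 = UNIV"
      using Z0(2) Z(2) by (metis closure_closure closure_mono top.extremum_unique)
    \<comment> \<open>The vectors \<open>x \<gamma>\<close> need not lie in \<open>Y0\<close>. The
      extension makes each \<open>f (s n) o\<^sub>L T'\<close> a functional on the whole space, with
      countable support on the basis.\<close>
    obtain T' :: "'a \<Rightarrow>\<^sub>L 'a" where T': "\<And>u. u \<in> Y0 \<Longrightarrow> blinfun_apply T' u = T u"
      using bounded_linear_extension_dense[OF Y0(1) \<open>closure Y0 = UNIV\<close> T(2,3,4)] by blast
    have T'_Z: "blinfun_apply T' y \<in> Z" if "y \<in> Y0" for y
      using T'[OF that] bij_betwE[OF T(1)] that Z0(1) by auto
    define D where "D = (\<Union>n. {\<gamma>\<in>\<Gamma>. blinfun_apply (f (s n) o\<^sub>L T') (x \<gamma>) \<noteq> 0})"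
    have "countable D"
      unfolding D_def
      by (intro countable_UN countableI_type supp[unfolded countably_supports_dual_def, rule_format])
    \<comment> \<open>In the finite expansion of \<open>y\<close>, the coefficients vanish for
      indices in \<open>D\<close>, and \<open>f (s n) o\<^sub>L T'\<close> vanishes on the basis
      vectors with index outside \<open>D\<close>.\<close>
    have kernel: "blinfun_apply (f a) (blinfun_apply T' y) = 0"
      if y: "y \<in> Y0" "\<forall>\<gamma>\<in>D. blinfun_apply (f \<gamma>) y = 0" and a: "a \<in> A" for y a
    proof (rule detect[OF T'_Z[OF y(1)] _ a], rule allI)
      fix n
      obtain F where F: "finite F" "F \<subseteq> \<Gamma>" "y = (\<Sum>\<gamma>\<in>F. blinfun_apply (f \<gamma>) y *\<^sub>R x \<gamma>)"
        using biorthogonal_system_expansion[OF B Y0_span[OF y(1)]] by metis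
      have "blinfun_apply (f (s n) o\<^sub>L T') y
          = (\<Sum>\<gamma>\<in>F. blinfun_apply (f \<gamma>) y * blinfun_apply (f (s n) o\<^sub>L T') (x \<gamma>))"
        by (subst F(3)) (simp only: blinfun.sum_right blinfun.scaleR_right real_scaleR_def)
      also have "\<dots> = 0"
        using y(2) F(2) unfolding D_def by (intro sum.neutral) auto
      finally show "blinfun_apply (f (s n)) (blinfun_apply T' y) = 0"
        by simp
    qed
    \<comment> \<open>On \<open>V E\<close>, the finitely many functionals \<open>f \<gamma>\<close>
      with \<open>\<gamma> \<in> E\<close> control all \<open>D\<close>-coordinates. On their common
      kernel every \<open>A\<close>-coordinate of \<open>T' y\<close> is zero by
      \<open>kernel\<close>, so \<open>countable_total_support\<close> applies.\<close>
    define V where "V E = {y\<in>Y0. \<forall>\<gamma>\<in>D - E. blinfun_apply (f \<gamma>) y = 0}" for E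
    have "countable {a\<in>A. \<exists>y\<in>V E. blinfun_apply (f a) (blinfun_apply T' y) \<noteq> 0}"
      if "finite E" for E
    proof (rule countable_total_support[OF that, where \<phi> = "\<lambda>\<gamma>. blinfun_apply (f \<gamma>)"])
      show "subspace (V E)"
        using Y0(1) unfolding V_def subspace_def
        by (auto simp: blinfun.add_right blinfun.scaleR_right blinfun.zero_right)
      show "linear (blinfun_apply (f \<gamma>))" for \<gamma>
        by (intro bounded_linear.linear blinfun.bounded_linear_right)
      show "linear (\<lambda>y. blinfun_apply (f a) (blinfun_apply T' y))" for a
        by (intro bounded_linear.linear bounded_linear_intros)
      show "countable {a\<in>A. blinfun_apply (f a) (blinfun_apply T' y) \<noteq> 0}" if "y \<in> V E" for y
        using fin T'_Z that unfolding V_def by (blast intro: countable_finite)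
      have "{a\<in>A. \<exists>y\<in>V E. (\<forall>\<gamma>\<in>E. blinfun_apply (f \<gamma>) y = 0) \<and>
          blinfun_apply (f a) (blinfun_apply T' y) \<noteq> 0} = {}"
        using kernel unfolding V_def by blast
      then show "countable {a\<in>A. \<exists>y\<in>V E. (\<forall>\<gamma>\<in>E. blinfun_apply (f \<gamma>) y = 0) \<and>
          blinfun_apply (f a) (blinfun_apply T' y) \<noteq> 0}"
        by (metis countable_empty)
    qed
    \<comment> \<open>The countable set \<open>D\<close> has only countably many finite subsets
      \<open>E\<close>.\<close>
    then have "countable (\<Union>E\<in>{E. finite E \<and> E \<subseteq> D}.
        {a\<in>A. \<exists>y\<in>V E. blinfun_apply (f a) (blinfun_apply T' y) \<noteq> 0})"
      using \<open>countable D\<close> countable_Collect_finite_subset by (intro countable_UN) auto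
    moreover have "A \<subseteq> (\<Union>E\<in>{E. finite E \<and> E \<subseteq> D}.
        {a\<in>A. \<exists>y\<in>V E. blinfun_apply (f a) (blinfun_apply T' y) \<noteq> 0})"
    proof
      fix a assume "a \<in> A"
      \<comment> \<open>Otherwise \<open>f a\<close> would vanish on the closure of
        \<open>Z0\<close>, against the value 1 at \<open>x a\<close>.\<close>
      have "\<exists>z\<in>Z0. blinfun_apply (f a) z \<noteq> 0"
      proof (rule ccontr)
        assume "\<not> (\<exists>z\<in>Z0. blinfun_apply (f a) z \<noteq> 0)"
        moreover have "closed {z. blinfun_apply (f a) z = 0}"
          by (intro closed_Collect_eq continuous_intros)
        ultimately have "closure Z0 \<subseteq> {z. blinfun_apply (f a) z = 0}"
          by (intro closure_minimal) auto
        then have "blinfun_apply (f a) (x a) = 0"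
          using \<open>closure Z0 = UNIV\<close> by blast
        then show False
          using B \<open>a \<in> A\<close> A(1) unfolding biorthogonal_system_def by auto
      qed
      then obtain y where y: "y \<in> Y0" "blinfun_apply (f a) (blinfun_apply T' y) \<noteq> 0"
        using T(1) T' unfolding bij_betw_def by force
      obtain F where F: "finite F" "\<And>\<gamma>. \<gamma> \<in> \<Gamma> - F \<Longrightarrow> blinfun_apply (f \<gamma>) y = 0"
        using biorthogonal_system_expansion[OF B Y0_span[OF y(1)]] by metis
      have "D \<subseteq> \<Gamma>"
        unfolding D_def by blast
      \<comment> \<open>Finite support puts each \<open>y\<close> of \<open>Y0\<close> into some
        \<open>V E\<close> with \<open>E\<close> a finite subset of \<open>D\<close>.\<close>
      then have "y \<in> V (F \<inter> D)"
        using y(1) F(2) unfolding V_def by blast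
      then show "a \<in> (\<Union>E\<in>{E. finite E \<and> E \<subseteq> D}.
        {a\<in>A. \<exists>y\<in>V E. blinfun_apply (f a) (blinfun_apply T' y) \<noteq> 0})"
        using \<open>a \<in> A\<close> y(2) F(1) by blast
    qed
    ultimately show False
      using A(2) countable_subset by blast
  qed
  moreover have "dense_subspace_of Y UNIV" "dense_subspace_of Z UNIV"
    using dense Z unfolding dense_subspace_of_def Y_def by auto
  ultimately show ?thesis
    by blast
qed

end
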